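(* Let $D$ be a database and $\Pi$ a temporal linear DatalogMTL$_{\Diamond^-}$ program such that each cycle in the dependency graph of $\Pi$ is temporal-acyclic or has a positive interval weight. Then there exists a time point $T\in\mathbb Q$ such that for every $t>T$ and every ground atom $\alpha$: $\alpha@t\in\Pi(D)$ iff $\alpha@T\in\Pi(D)$.
   Context: DatalogMTL over $\mathbb Q$ with continuous semantics. Intervals $\langle t_1,t_2\rangle$, $t_1\le t_2$ in $\mathbb Q\cup\{\pm\infty\}$, ends open/closed; non-negative if contained in $[0,\infty)$. A fact is $A@\varrho$ with $A$ a ground atom; a database is a finite set of facts. A DatalogMTL$_{\Diamond^-}$ program is a finite set of rules of the forms $P_1(\boldsymbol\tau_1)\land\dots\land P_n(\boldsymbol\tau_n)\to P_0(\boldsymbol\tau_0)$ ($n\ge 0$) and $\Diamond^-_\varrho P_1(\boldsymbol\tau_1)\to P_0(\boldsymbol\tau_0)$ with $\varrho$ non-negative, where $\mathfrak M,t\models\Diamond^-_\varrho A$ iff $\mathfrak M,s\models A$ for some $s$ with $t-s\in\varrho$. A rule is satisfied if for every grounding and time $t$, body true at $t$ implies head true at $t$. $\Pi(D)$ is the minimum model of $\Pi$ and $D$; $\alpha@t\in\Pi(D)$ means $\alpha$ holds at $t$ in it. Dependency graph: vertices are predicates, an edge $(P,Q)$ for each rule with $P$ in body and $Q$ in head; the edge is special if the rule is of the $\Diamond^-$ form. Two predicates are temporal mutually recursive if they lie on a common cycle containing a special edge. A rule is temporal linear if at most one body predicate is temporal mutually recursive with the head; a program is temporal linear if all its rules are.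 Edge labels: $\varrho$ for a $\Diamond^-_\varrho$ rule, $[0,0]$ otherwise; the interval weight of a cycle is the Minkowski sum of its labels; the cycle is temporal-acyclic if its weight is $[0,0]$, and the weight with endpoints $t_1,t_2$ is positive if $0\le t_1<t_2$. *)

theory Defs
  imports Main "HOL.Rat" "HOL-Library.Extended" "HOL-Library.Set_Algebras"
begin

section \<open>Intervals\<close>

text \<open>
  An interval over the rationals is the set of its points. Saying that a set lies between the open
  and the closed interval with the given endpoints leaves both ends free to be open or closed.
  The endpoints are unique when \<open>t1 < t2\<close>; for \<open>t1 = t2\<close> the set is empty or a single point.
\<close>

definition has_endpoints :: "rat set \<Rightarrow> rat extended \<Rightarrow> rat extended \<Rightarrow> bool" where
  "has_endpoints I t1 t2 \<longleftrightarrow>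
     {t. t1 < Fin t \<and> Fin t < t2} \<subseteq> I \<and> I \<subseteq> {t. t1 \<le> Fin t \<and> Fin t \<le> t2}"

definition is_interval :: "rat set \<Rightarrow> bool" where
  "is_interval I \<longleftrightarrow> (\<exists>t1 t2. t1 \<le> t2 \<and> has_endpoints I t1 t2)"

definition nonneg_interval :: "rat set \<Rightarrow> bool" where
  "nonneg_interval I \<longleftrightarrow> is_interval I \<and> I \<subseteq> {0..}"

definition positive_interval :: "rat set \<Rightarrow> bool" where
  "positive_interval I \<longleftrightarrow> (\<exists>t1 t2. has_endpoints I t1 t2 \<and> Fin 0 \<le> t1 \<and> t1 < t2)"

section \<open>Syntax\<close>

datatype ('c, 'v) trm = Const 'c | Var 'v

datatype ('p, 'a) atom = Atom (pred: 'p) (args: "'a list")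

type_synonym ('p, 'c) gatom = "('p, 'c) atom"

type_synonym ('p, 'c) fact = "('p, 'c) gatom \<times> rat set"

text \<open>
  \<open>Conj [B\<^sub>1, \<dots>, B\<^sub>n] H\<close> is \<open>B\<^sub>1 \<and> \<dots> \<and> B\<^sub>n \<rightarrow> H\<close>, and \<open>Dia I B H\<close> is \<open>\<diamond>\<^sup>-\<^sub>I B \<rightarrow> H\<close>.
\<close>

datatype ('p, 'c, 'v) rule =
    Conj "('p, ('c, 'v) trm) atom list" "('p, ('c, 'v) trm) atom"
  | Dia "rat set" "('p, ('c, 'v) trm) atom" "('p, ('c, 'v) trm) atom"

fun head :: "('p, 'c, 'v) rule \<Rightarrow> ('p, ('c, 'v) trm) atom" where
  "head (Conj Bs H) = H"
| "head (Dia I B H) = H"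

fun body :: "('p, 'c, 'v) rule \<Rightarrow> ('p, ('c, 'v) trm) atom set" where
  "body (Conj Bs H) = set Bs"
| "body (Dia I B H) = {B}"

fun is_dia :: "('p, 'c, 'v) rule \<Rightarrow> bool" where
  "is_dia (Conj Bs H) \<longleftrightarrow> False"
| "is_dia (Dia I B H) \<longleftrightarrow> True"

fun label :: "('p, 'c, 'v) rule \<Rightarrow> rat set" where
  "label (Conj Bs H) = {0}"
| "label (Dia I B H) = I"

definition database :: "('p, 'c) fact set \<Rightarrow> bool" where
  "database D \<longleftrightarrow> finite D \<and> (\<forall>(A, I) \<in> D. is_interval I)"

definition program :: "('p, 'c, 'v) rule set \<Rightarrow> bool" where
  "program \<Pi> \<longleftrightarrow> finite \<Pi> \<and> (\<forall>I B H. Dia I B H \<in> \<Pi> \<longrightarrow> nonneg_interval I)"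

section \<open>Semantics\<close>

type_synonym ('p, 'c) interp = "(('p, 'c) gatom \<times> rat) set"

fun subst :: "('v \<Rightarrow> 'c) \<Rightarrow> ('c, 'v) trm \<Rightarrow> 'c" where
  "subst \<sigma> (Const c) = c"
| "subst \<sigma> (Var v) = \<sigma> v"

definition ground :: "('v \<Rightarrow> 'c) \<Rightarrow> ('p, ('c, 'v) trm) atom \<Rightarrow> ('p, 'c) gatom" where
  "ground \<sigma> = map_atom id (subst \<sigma>)"

fun body_holds :: "('p, 'c) interp \<Rightarrow> rat \<Rightarrow> ('v \<Rightarrow> 'c) \<Rightarrow> ('p, 'c, 'v) rule \<Rightarrow> bool" where
  "body_holds M t \<sigma> (Conj Bs H) \<longleftrightarrow> (\<forall>B \<in> set Bs. (ground \<sigma> B, t) \<in> M)"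
| "body_holds M t \<sigma> (Dia I B H) \<longleftrightarrow> (\<exists>s. t - s \<in> I \<and> (ground \<sigma> B, s) \<in> M)"

definition sat_rule :: "('p, 'c) interp \<Rightarrow> ('p, 'c, 'v) rule \<Rightarrow> bool" where
  "sat_rule M r \<longleftrightarrow> (\<forall>\<sigma> t. body_holds M t \<sigma> r \<longrightarrow> (ground \<sigma> (head r), t) \<in> M)"

definition sat_fact :: "('p, 'c) interp \<Rightarrow> ('p, 'c) fact \<Rightarrow> bool" where
  "sat_fact M = (\<lambda>(A, I). \<forall>t \<in> I. (A, t) \<in> M)"

definition is_model :: "('p, 'c, 'v) rule set \<Rightarrow> ('p, 'c) fact set \<Rightarrow> ('p, 'c) interp \<Rightarrow> bool" where
  "is_model \<Pi> D M \<longleftrightarrow> (\<forall>r \<in> \<Pi>. sat_rule M r) \<and> (\<forall>f \<in> D. sat_fact M f)"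

definition min_model :: "('p, 'c, 'v) rule set \<Rightarrow> ('p, 'c) fact set \<Rightarrow> ('p, 'c) interp" where
  "min_model \<Pi> D = \<Inter> {M. is_model \<Pi> D M}"

lemma body_holds_mono:
  "body_holds M t \<sigma> r \<Longrightarrow> M \<subseteq> N \<Longrightarrow> body_holds N t \<sigma> r"
  by (cases r) auto

lemma min_model_is_model: "is_model \<Pi> D (min_model \<Pi> D)"
proof -
  have "sat_rule (min_model \<Pi> D) r" if "r \<in> \<Pi>" for r
    unfolding sat_rule_def
  proof (intro allI impI)
    fix \<sigma> t assume "body_holds (min_model \<Pi> D) t \<sigma> r"
    then have "body_holds M t \<sigma> r" if "is_model \<Pi> D M" for M
      using that by (auto simp: min_model_def elim!: body_holds_mono)
    then show "(ground \<sigma> (head r), t) \<in> min_model \<Pi> D"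
      using that by (auto simp: min_model_def is_model_def sat_rule_def)
  qed
  moreover have "sat_fact (min_model \<Pi> D) f" if "f \<in> D" for f
    using that by (fastforce simp: min_model_def is_model_def sat_fact_def)
  ultimately show ?thesis by (simp add: is_model_def)
qed

lemma min_model_least: "is_model \<Pi> D M \<Longrightarrow> min_model \<Pi> D \<subseteq> M"
  by (auto simp: min_model_def)

section \<open>Dependency graph\<close>

text \<open>
  The graph is a multigraph: an edge carries the rule it stems from, so parallel edges between the
  same predicates keep their own labels.
\<close>

type_synonym ('p, 'c, 'v) edge = "'p \<times> ('p, 'c, 'v) rule \<times> 'p"

fun src :: "('p, 'c, 'v) edge \<Rightarrow> 'p" where "src (P, r, Q) = P"
fun tgt :: "('p, 'c, 'v) edge \<Rightarrow> 'p" where "tgt (P, r, Q) = Q"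
fun rule_of :: "('p, 'c, 'v) edge \<Rightarrow> ('p, 'c, 'v) rule" where "rule_of (P, r, Q) = r"

definition dep_edges :: "('p, 'c, 'v) rule set \<Rightarrow> ('p, 'c, 'v) edge set" where
  "dep_edges \<Pi> = {(pred B, r, pred (head r)) | B r. r \<in> \<Pi> \<and> B \<in> body r}"

text \<open>
  Cycles are closed walks and may repeat vertices. Hence two predicates lie on a common cycle
  with a special edge iff they belong to one strongly connected component containing such an edge.
\<close>

definition is_cycle :: "('p, 'c, 'v) rule set \<Rightarrow> ('p, 'c, 'v) edge list \<Rightarrow> bool" where
  "is_cycle \<Pi> es \<longleftrightarrow> es \<noteq> [] \<and> set es \<subseteq> dep_edges \<Pi> \<and>
     (\<forall>i < length es. tgt (es ! i) = src (es ! (Suc i mod length es)))"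

text \<open>The sum of sets is the Minkowski sum.\<close>

definition weight :: "('p, 'c, 'v) edge list \<Rightarrow> rat set" where
  "weight es = sum_list (map (label \<circ> rule_of) es)"

definition temporal_acyclic :: "('p, 'c, 'v) edge list \<Rightarrow> bool" where
  "temporal_acyclic es \<longleftrightarrow> weight es = {0}"

definition temporal_mut_rec :: "('p, 'c, 'v) rule set \<Rightarrow> 'p \<Rightarrow> 'p \<Rightarrow> bool" where
  "temporal_mut_rec \<Pi> P Q \<longleftrightarrow>
     (\<exists>es. is_cycle \<Pi> es \<and> P \<in> src ` set es \<and> Q \<in> src ` set es \<and> (\<exists>e \<in> set es. is_dia (rule_of e)))"

text \<open>
  The recursive body atoms are counted, not their predicate symbols: \<open>P(x) \<and> P(y) \<rightarrow> P(z)\<close> has two of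
  them if \<open>P\<close> is temporal mutually recursive with itself.
\<close>

definition temporal_linear_rule :: "('p, 'c, 'v) rule set \<Rightarrow> ('p, 'c, 'v) rule \<Rightarrow> bool" where
  "temporal_linear_rule \<Pi> r \<longleftrightarrow>
     card {B \<in> body r. temporal_mut_rec \<Pi> (pred B) (pred (head r))} \<le> 1"

definition temporal_linear :: "('p, 'c, 'v) rule set \<Rightarrow> bool" where
  "temporal_linear \<Pi> \<longleftrightarrow> (\<forall>r \<in> \<Pi>. temporal_linear_rule \<Pi> r)"

end

theory Submission
  imports Defs
begin

text \<open>
  Induct along the strongly connected components of the dependency graph. Beyond some time the facts
  and everything coming from lower components are constant. In a component without special edges,
  what is derivable at one late time is then derivable at all. In a component with a special edge,
  consider the graph of classes of ground atoms with equal predicate and equal truth set; it is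
  finite, because constants not occurring in \<open>\<Pi>\<close> and \<open>D\<close> are interchangeable. Linearity makes late
  derivations walks in this graph. A class on a cycle of positive weight that holds
  at one late time holds at all sufficiently late times. On all other classes, edges with label other than
  \<open>{0}\<close> strictly increase the number of predecessors, which bounds how late such a class can hold.
\<close>

section \<open>Eventually constant sets of time points\<close>

text \<open>Since both times range freely, \<open>X\<close> contains either all or none of the times
  after \<open>T\<close>. Nothing is said about \<open>T\<close> itself.\<close>

definition const_beyond :: "rat \<Rightarrow> rat set \<Rightarrow> bool" where
  "const_beyond T X \<longleftrightarrow> (\<forall>t > T. \<forall>t' > T. t \<in> X \<longrightarrow> t' \<in> X)"

definition ev_const :: "rat set \<Rightarrow> bool" where
  "ev_const X \<longleftrightarrow> (\<exists>T. const_beyond T X)"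

definition ev_full :: "rat set \<Rightarrow> bool" where
  "ev_full X \<longleftrightarrow> (\<exists>T. {T<..} \<subseteq> X)"

text \<open>This is the Minkowski sum of \<open>I\<close> and \<open>X\<close>: the times at which
  the past diamond over \<open>I\<close> holds for an atom true exactly on \<open>X\<close>.\<close>

definition shift :: "rat set \<Rightarrow> rat set \<Rightarrow> rat set" where
  "shift I X = {t. \<exists>s. t - s \<in> I \<and> s \<in> X}"

lemma const_beyondD: "const_beyond T X \<Longrightarrow> t \<in> X \<Longrightarrow> T < t \<Longrightarrow> T < t' \<Longrightarrow> t' \<in> X"
  unfolding const_beyond_def by blast

lemma const_beyond_mono: "const_beyond T X \<Longrightarrow> T \<le> T' \<Longrightarrow> const_beyond T' X"
  unfolding const_beyond_def using le_less_trans by blast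

lemma ev_fullI: "(\<And>t. T < t \<Longrightarrow> t \<in> X) \<Longrightarrow> ev_full X"
  by (auto simp: ev_full_def)

lemma ev_full_const: "ev_full X \<Longrightarrow> ev_const X"
  unfolding ev_full_def ev_const_def const_beyond_def by blast

lemma const_beyond_full: "const_beyond T X \<Longrightarrow> t \<in> X \<Longrightarrow> T < t \<Longrightarrow> ev_full X"
  unfolding ev_full_def using const_beyondD by blast

lemma bounded_ev_const: "(\<And>t. t \<in> X \<Longrightarrow> t \<le> T) \<Longrightarrow> ev_const X"
  unfolding ev_const_def const_beyond_def by (intro exI[of _ T]) (auto simp: not_le[symmetric])

lemma ev_const_cases:
  assumes "ev_const X"
  obtains "ev_full X" | T where "\<And>t. t \<in> X \<Longrightarrow> t \<le> T"
proof -
  obtain T where "const_beyond T X" using assms by (auto simp: ev_const_def)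
  then show thesis using that const_beyond_full[of T X] by (cases "\<exists>t \<in> X. T < t") (auto simp: not_less)
qed

lemma finite_common_bound:
  fixes P :: "'x \<Rightarrow> rat \<Rightarrow> bool"
  assumes "finite F" and "\<And>x. x \<in> F \<Longrightarrow> \<exists>T. P x T"
    and "\<And>x T T'. P x T \<Longrightarrow> T \<le> T' \<Longrightarrow> P x T'"
  shows "\<exists>T. \<forall>x \<in> F. P x T"
  using assms(1,2)
proof (induction F)
  case (insert x F)
  then obtain T T' where "P x T" "\<forall>y \<in> F. P y T'" by blast
  then have "\<forall>y \<in> insert x F. P y (max T T')"
    using assms(3) by (metis insertE max.cobounded1 max.cobounded2)
  then show ?case by blast
qed simp

lemma finite_ev_const:
  assumes "finite F" "\<And>X. X \<in> F \<Longrightarrow> ev_const X"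
  shows "\<exists>T. \<forall>X \<in> F. const_beyond T X"
proof (rule finite_common_bound[OF assms(1)])
  show "\<exists>T. const_beyond T X" if "X \<in> F" for X using assms(2)[OF that] by (simp add: ev_const_def)
qed (rule const_beyond_mono)

text \<open>The right endpoint decides: a finite one bounds \<open>I\<close>, an infinite one leaves
  a whole final segment unless \<open>I\<close> is empty.\<close>

lemma interval_bounded_or_ev_full:
  assumes "is_interval I"
  shows "(\<exists>R. \<forall>i \<in> I. i \<le> R) \<or> ev_full I"
proof -
  obtain t1 t2 where e: "has_endpoints I t1 t2"
    using assms by (auto simp: is_interval_def)
  show ?thesis
  proof (cases t2)
    case (Fin R)
    then show ?thesis using e by (auto simp: has_endpoints_def)
  next
    case Pinf
    show ?thesis
    proof (cases t1)
      case (Fin a)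
      then show ?thesis using e Pinf by (auto simp: has_endpoints_def ev_full_def)
    next
      case Pinf
      then show ?thesis using e by (auto simp: has_endpoints_def)
    next
      case Minf
      then have "I = UNIV" using e Pinf by (auto simp: has_endpoints_def)
      then show ?thesis by (simp add: ev_full_def)
    qed
  next
    case Minf
    then show ?thesis using e by (auto simp: has_endpoints_def)
  qed
qed

lemma interval_ev_const: "is_interval I \<Longrightarrow> ev_const I"
  using interval_bounded_or_ev_full[of I] bounded_ev_const[of I] ev_full_const[of I] by auto

lemma ev_full_shift_right: "ev_full X \<Longrightarrow> i \<in> I \<Longrightarrow> ev_full (shift I X)"
proof -
  assume "ev_full X" "i \<in> I"
  then obtain T where T: "\<And>t. T < t \<Longrightarrow> t \<in> X" by (auto simp: ev_full_def)
  show ?thesis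
  proof (rule ev_fullI)
    fix t assume "T + i < t"
    then have "t - i \<in> X" using T by simp
    then show "t \<in> shift I X"
      using \<open>i \<in> I\<close> by (auto simp: shift_def intro!: exI[of _ "t - i"])
  qed
qed

lemma ev_full_shift_left: "ev_full I \<Longrightarrow> s \<in> X \<Longrightarrow> ev_full (shift I X)"
proof -
  assume "ev_full I" "s \<in> X"
  then obtain T where T: "\<And>t. T < t \<Longrightarrow> t \<in> I" by (auto simp: ev_full_def)
  show ?thesis
  proof (rule ev_fullI)
    fix t assume "T + s < t"
    then have "t - s \<in> I" using T by simp
    then show "t \<in> shift I X" using \<open>s \<in> X\<close> by (auto simp: shift_def)
  qed
qed

text \<open>For non-empty sets, one eventually full summand makes the sum eventually full. Otherwise
  both are bounded above, and so is their sum.\<close>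

lemma ev_const_shift:
  assumes "is_interval I" "ev_const X"
  shows "ev_const (shift I X)"
proof (cases "I = {} \<or> X = {}")
  case True
  then show ?thesis by (auto simp: shift_def ev_const_def const_beyond_def)
next
  case False
  show ?thesis
    using assms(2)
  proof (cases rule: ev_const_cases)
    case 1
    then show ?thesis using False ev_full_shift_right ev_full_const by blast
  next
    case (2 T)
    show ?thesis
    proof (cases "ev_full I")
      case True
      then show ?thesis using False ev_full_shift_left ev_full_const by blast
    next
      case False
      then obtain R where R: "\<And>i. i \<in> I \<Longrightarrow> i \<le> R"
        using interval_bounded_or_ev_full[OF assms(1)] by blast
      have "t \<le> R + T" if "t \<in> shift I X" for t
        using that R 2 by (force simp: shift_def)
      then show ?thesis by (rule bounded_ev_const)
    qed
  qed
qed

text \<open>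
  Every sufficiently large \<open>d\<close> is a multiple \<open>k * w\<close> with \<open>w\<close> in a fixed nondegenerate interval:
  this is what positivity of a cycle weight buys.
\<close>

lemma positive_closed_ev_full:
  assumes x: "x \<in> X" "T < x" and W: "positive_interval W"
    and closed: "\<And>y w. y \<in> X \<Longrightarrow> T < y \<Longrightarrow> w \<in> W \<Longrightarrow> y + w \<in> X"
  shows "ev_full X"
proof -
  obtain t1 t2 where t: "has_endpoints W t1 t2" "Fin 0 \<le> t1" "t1 < t2"
    using W by (auto simp: positive_interval_def)
  obtain p where p: "t1 = Fin p" "0 \<le> p" using t(2,3) by (cases t1; cases t2) auto
  obtain q where q: "p < q" "Fin q \<le> t2"
  proof (cases t2)
    case (Fin r)
    then show ?thesis using that[of r] t(3) p by simp
  next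
    case Pinf
    then show ?thesis using that[of "p + 1"] by simp
  qed (use t(3) in auto)
  \<comment> \<open>The closed segment from \<open>a\<close> to \<open>b\<close> lies strictly
    inside the interval, whatever its ends. As \<open>a\<close> is positive, division by it is
    possible and iteration stays beyond \<open>T\<close>.\<close>
  define a b where "a = p + (q - p) / 3" and "b = p + 2 * (q - p) / 3"
  have ab: "0 < a" "a < b" "p < a" "b < q" using p q by (auto simp: a_def b_def field_simps)
  have inW: "w \<in> W" if "a \<le> w" "w \<le> b" for w
  proof -
    have "t1 < Fin w" using that ab p by simp
    moreover have "Fin w < Fin q" using that ab by simp
    then have "Fin w < t2" using q(2) by (rule less_le_trans)
    ultimately show ?thesis using t(1) by (auto simp: has_endpoints_def)
  qed
  have iter: "x + of_nat k * w \<in> X" if "a \<le> w" "w \<le> b" for k w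
  proof (induction k)
    case (Suc k)
    have "0 \<le> of_nat k * w" using that ab by simp
    then have "T < x + of_nat k * w" using x by simp
    with Suc have "x + of_nat k * w + w \<in> X" using closed inW that by blast
    then show ?case by (simp add: algebra_simps)
  qed (use x in simp)
  show ?thesis
  proof (rule ev_fullI)
    \<comment> \<open>Once the distance \<open>d\<close> from \<open>x\<close> exceeds
      \<open>a * b / (b - a)\<close>, the numbers \<open>d / b\<close> and \<open>d / a\<close>
      differ by at least 1, so the integer \<open>k\<close> fits between them. The summand
      \<open>a\<close> ensures that \<open>k\<close> is at least 1.\<close>
    fix t assume t: "x + (a + a * b / (b - a)) < t"
    define d where "d = t - x"
    define k where "k = nat \<lfloor>d / a\<rfloor>"
    have "0 < a * b / (b - a)" using ab by simp
    then have d: "a < d" "a * b / (b - a) < d" using t ab(1) unfolding d_def by linarith+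
    then have "1 \<le> d / a" using ab by simp
    then have k: "of_nat k = rat_of_int \<lfloor>d / a\<rfloor>" "1 \<le> k"
      by (auto simp: k_def le_nat_iff)
    have k1: "of_nat k \<le> d / a" "d / a < of_nat k + 1"
      unfolding k by linarith+
    have "d / b \<le> d / a - 1" using d ab by (simp add: field_simps)
    then have "d / b \<le> of_nat k" using k1 by linarith
    then have "d / of_nat k \<le> b" using ab k(2) by (simp add: field_simps)
    moreover have "a \<le> d / of_nat k" using k1 k(2) ab by (simp add: field_simps)
    ultimately have "x + of_nat k * (d / of_nat k) \<in> X" by (intro iter)
    then show "t \<in> X" using k by (simp add: d_def)
  qed
qed

section \<open>Walks and cycles\<close>

fun walk :: "('p, 'c, 'v) rule set \<Rightarrow> 'p \<Rightarrow> ('p, 'c, 'v) edge list \<Rightarrow> 'p \<Rightarrow> bool" where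
  "walk \<Pi> P [] Q \<longleftrightarrow> P = Q"
| "walk \<Pi> P (e # es) Q \<longleftrightarrow> e \<in> dep_edges \<Pi> \<and> src e = P \<and> walk \<Pi> (tgt e) es Q"

lemma walk_append:
  "walk \<Pi> P (es @ es') Q \<longleftrightarrow> (\<exists>P'. walk \<Pi> P es P' \<and> walk \<Pi> P' es' Q)"
  by (induction es arbitrary: P) auto

lemma walk_nth:
  "walk \<Pi> P es Q \<Longrightarrow> i < length es \<Longrightarrow>
     tgt (es ! i) = (if Suc i < length es then src (es ! Suc i) else Q)"
proof (induction es arbitrary: P i)
  case (Cons e es)
  then show ?case
    by (cases i; cases es) auto
qed simp

lemma walk_set: "walk \<Pi> P es Q \<Longrightarrow> set es \<subseteq> dep_edges \<Pi>"
  by (induction es arbitrary: P) auto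

lemma walk_src: "walk \<Pi> P es Q \<Longrightarrow> es \<noteq> [] \<Longrightarrow> src (es ! 0) = P"
  by (cases es) auto

lemma closed_walk_is_cycle:
  assumes "walk \<Pi> P es P" "es \<noteq> []"
  shows "is_cycle \<Pi> es"
proof -
  have "tgt (es ! i) = src (es ! (Suc i mod length es))" if i: "i < length es" for i
  proof (cases "Suc i < length es")
    case True
    then show ?thesis using walk_nth[OF assms(1) i] by simp
  next
    case False
    then have "Suc i = length es" using i by simp
    then show ?thesis using walk_nth[OF assms(1) i] walk_src[OF assms] by simp
  qed
  then show ?thesis using assms(2) walk_set[OF assms(1)] by (simp add: is_cycle_def)
qed

section \<open>Reachability between predicates and cycles through a special edge\<close>

definition dep_rel :: "('p, 'c, 'v) rule set \<Rightarrow> ('p \<times> 'p) set" where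
  "dep_rel \<Pi> = (\<lambda>e. (src e, tgt e)) ` dep_edges \<Pi>"

lemma dep_relI: "r \<in> \<Pi> \<Longrightarrow> B \<in> body r \<Longrightarrow> (pred B, pred (head r)) \<in> dep_rel \<Pi>"
  by (force simp: dep_rel_def dep_edges_def)

lemma dep_rtrancl_walk: "(P, Q) \<in> (dep_rel \<Pi>)\<^sup>* \<Longrightarrow> \<exists>es. walk \<Pi> P es Q"
proof (induction rule: converse_rtrancl_induct)
  case base
  show ?case by (rule exI[of _ "[]"]) simp
next
  case (step P P')
  then obtain e es where "e \<in> dep_edges \<Pi>" "P = src e" "P' = tgt e" "walk \<Pi> P' es Q"
    by (auto simp: dep_rel_def)
  then have "walk \<Pi> P (e # es) Q" by simp
  then show ?case by blast
qed

lemma finite_rtrancl_predecessors: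
  assumes "finite E"
  shows "finite {u. (u, v) \<in> E\<^sup>*}"
proof (rule finite_subset)
  have "u \<in> insert v (fst ` E)" if "(u, v) \<in> E\<^sup>*" for u
    using that by (cases rule: converse_rtranclE) force+
  then show "{u. (u, v) \<in> E\<^sup>*} \<subseteq> insert v (fst ` E)" by blast
  show "finite (insert v (fst ` E))" using assms by simp
qed

lemma finite_body: "finite (body r)"
  by (cases r) auto

lemma finite_dep_edges: "finite \<Pi> \<Longrightarrow> finite (dep_edges \<Pi>)"
proof -
  assume "finite \<Pi>"
  moreover have "dep_edges \<Pi> = (\<Union>r \<in> \<Pi>. (\<lambda>B. (pred B, r, pred (head r))) ` body r)"
    by (auto simp: dep_edges_def)
  ultimately show ?thesis by (simp add: finite_body)
qed

text \<open>Walks from \<open>P\<close> to \<open>P'\<close>, on to \<open>pred B\<close>, over the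
  special edge to \<open>pred H\<close> and back to \<open>P\<close> concatenate to one cycle.
  Repeated vertices are harmless because cycles are closed walks.\<close>

lemma temporal_mut_recI:
  assumes dia: "Dia I B H \<in> \<Pi>"
    and "(P, P') \<in> (dep_rel \<Pi>)\<^sup>*" "(P', pred B) \<in> (dep_rel \<Pi>)\<^sup>*" "(pred H, P) \<in> (dep_rel \<Pi>)\<^sup>*"
  shows "temporal_mut_rec \<Pi> P P'"
proof -
  obtain es1 es2 es3 where w: "walk \<Pi> P es1 P'" "walk \<Pi> P' es2 (pred B)" "walk \<Pi> (pred H) es3 P"
    using assms(2-4) dep_rtrancl_walk by meson
  define e where "e = (pred B, Dia I B H, pred H)"
  have "e \<in> dep_edges \<Pi>" using dia by (force simp: e_def dep_edges_def)
  define es' where "es' = es2 @ e # es3"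
  have w': "walk \<Pi> P' es' P" "es' \<noteq> []"
    using w \<open>e \<in> _\<close> by (auto simp: es'_def walk_append e_def)
  define es where "es = es1 @ es'"
  have c: "walk \<Pi> P es P" "es \<noteq> []" using w w' by (auto simp: es_def walk_append)
  have "P' \<in> src ` set es'" using walk_src[OF w'] w'(2) by (metis image_eqI length_greater_0_conv nth_mem)
  then have "P' \<in> src ` set es" by (auto simp: es_def)
  moreover have "P \<in> src ` set es" using walk_src[OF c] c(2) by (metis image_eqI length_greater_0_conv nth_mem)
  moreover have "e \<in> set es" "is_dia (rule_of e)" by (auto simp: es_def es'_def e_def)
  ultimately show ?thesis
    using closed_walk_is_cycle[OF c] by (auto simp: temporal_mut_rec_def)
qed

section \<open>Finitely many behaviours of ground atoms\<close>

text \<open>The part of the minimum model that satisfies \<open>P\<close> is itself a model, so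
  minimality makes it everything. Intersecting in the rule case supplies membership in the model
  along with the induction hypothesis.\<close>

lemma min_model_induct [consumes 1, case_names rule fact]:
  assumes "(\<alpha>, t) \<in> min_model \<Pi> D"
    and "\<And>r \<sigma> t. r \<in> \<Pi> \<Longrightarrow> body_holds (min_model \<Pi> D \<inter> {(\<alpha>, t). P \<alpha> t}) t \<sigma> r
            \<Longrightarrow> P (ground \<sigma> (head r)) t"
    and "\<And>A I t. (A, I) \<in> D \<Longrightarrow> t \<in> I \<Longrightarrow> P A t"
  shows "P \<alpha> t"
proof -
  let ?M = "min_model \<Pi> D" and ?N = "min_model \<Pi> D \<inter> {(\<alpha>, t). P \<alpha> t}"
  have M: "is_model \<Pi> D ?M" by (rule min_model_is_model)
  have "is_model \<Pi> D ?N"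
    unfolding is_model_def
  proof (intro conjI ballI)
    fix r assume "r \<in> \<Pi>"
    show "sat_rule ?N r"
      unfolding sat_rule_def
    proof (intro allI impI)
      fix \<sigma> t assume b: "body_holds ?N t \<sigma> r"
      then have "body_holds ?M t \<sigma> r" by (rule body_holds_mono) blast
      then have "(ground \<sigma> (head r), t) \<in> ?M"
        using M \<open>r \<in> \<Pi>\<close> by (auto simp: is_model_def sat_rule_def)
      then show "(ground \<sigma> (head r), t) \<in> ?N" using assms(2)[OF \<open>r \<in> \<Pi>\<close> b] by simp
    qed
  next
    fix f assume "f \<in> D"
    then show "sat_fact ?N f"
      using M assms(3) by (cases f) (fastforce simp: is_model_def sat_fact_def)
  qed
  then show ?thesis using min_model_least assms(1) by blast
qed

locale past_datalog =
  fixes \<Pi> :: "('p, 'c, 'v) rule set" and D :: "('p, 'c) fact set"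
  assumes db: "database D" and prog: "program \<Pi>"
begin

abbreviation "M \<equiv> min_model \<Pi> D"

definition extent :: "('p, 'c) gatom \<Rightarrow> rat set" where
  "extent \<alpha> = {t. (\<alpha>, t) \<in> M}"

lemma extent_iff: "t \<in> extent \<alpha> \<longleftrightarrow> (\<alpha>, t) \<in> M"
  by (simp add: extent_def)

lemma conj_rule: "Conj Bs H \<in> \<Pi> \<Longrightarrow> \<forall>B \<in> set Bs. t \<in> extent (ground \<sigma> B) \<Longrightarrow> t \<in> extent (ground \<sigma> H)"
  using min_model_is_model[of \<Pi> D] by (fastforce simp: extent_iff is_model_def sat_rule_def)

lemma dia_rule: "Dia I B H \<in> \<Pi> \<Longrightarrow> shift I (extent (ground \<sigma> B)) \<subseteq> extent (ground \<sigma> H)"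
  using min_model_is_model[of \<Pi> D] by (fastforce simp: extent_iff is_model_def sat_rule_def shift_def)

lemma fact_extent: "(A, I) \<in> D \<Longrightarrow> I \<subseteq> extent A"
  using min_model_is_model[of \<Pi> D] by (fastforce simp: extent_iff is_model_def sat_fact_def)

section \<open>Renaming of constants and argument patterns of ground atoms\<close>

definition rename :: "('c \<Rightarrow> 'c) \<Rightarrow> ('p, 'c) gatom \<Rightarrow> ('p, 'c) gatom" where
  "rename h \<alpha> = Atom (pred \<alpha>) (map h (args \<alpha>))"

definition constants :: "'c set" where
  "constants = (\<Union>r \<in> \<Pi>. \<Union>A \<in> insert (head r) (body r). \<Union>x \<in> set (args A). set1_trm x) \<union>
     (\<Union>f \<in> D. set (args (fst f)))"

lemma finite_constants: "finite constants"
proof -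
  have "finite (set1_trm x)" for x :: "('c, 'v) trm" by (cases x) auto
  then show ?thesis
    using db prog by (auto simp: constants_def finite_body database_def program_def)
qed

lemma map_ground:
  assumes "r \<in> \<Pi>" "A \<in> insert (head r) (body r)" "\<forall>c \<in> constants. h c = c"
  shows "rename h (ground \<sigma> A) = ground (h \<circ> \<sigma>) A"
proof -
  have "h (subst \<sigma> x) = subst (h \<circ> \<sigma>) x" if "x \<in> set (args A)" for x
  proof (cases x)
    case (Const c)
    then have "c \<in> constants" using that assms(1,2) by (force simp: constants_def)
    then show ?thesis using assms(3) Const by simp
  qed simp
  then show ?thesis by (cases A) (simp add: ground_def rename_def)
qed

text \<open>Applying \<open>h\<close> to a derivation gives a derivation, with each grounding
  \<sigma> replaced by \<open>h \<circ> \<sigma>\<close>. Rule bodies only demand that atoms hold,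
  so this survives even if \<open>h\<close> identifies constants.\<close>

lemma extent_rename:
  assumes h: "\<forall>c \<in> constants. h c = c"
  shows "extent \<alpha> \<subseteq> extent (rename h \<alpha>)"
proof
  fix t assume "t \<in> extent \<alpha>"
  then have "(\<alpha>, t) \<in> M" by (simp add: extent_iff)
  then show "t \<in> extent (rename h \<alpha>)"
  proof (induction rule: min_model_induct)
    case (rule r \<sigma> t)
    have g: "rename h (ground \<sigma> A) = ground (h \<circ> \<sigma>) A" if "A \<in> insert (head r) (body r)" for A
      using map_ground rule(1) that h by blast
    show ?case
    proof (cases r)
      case (Conj Bs H)
      have "\<forall>B \<in> set Bs. t \<in> extent (ground (h \<circ> \<sigma>) B)"
        using rule(2) g Conj by auto
      then show ?thesis using conj_rule rule(1) Conj g by auto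
    next
      case (Dia I B H)
      then obtain s where "t - s \<in> I" "s \<in> extent (ground (h \<circ> \<sigma>) B)"
        using rule(2) g by auto
      then show ?thesis using dia_rule[of I B H "h \<circ> \<sigma>"] rule(1) Dia g by (auto simp: shift_def)
    qed
  next
    case (fact A I t)
    have "\<forall>c \<in> set (args A). h c = c" using fact(1) h by (force simp: constants_def)
    then have "rename h A = A" by (cases A) (simp add: rename_def map_idI)
    then show ?case using fact_extent fact by auto
  qed
qed

text \<open>Constants of the program and the database are kept. Any other is replaced by the
  position of its first occurrence, so only the pattern of equalities is remembered.\<close>

definition shape :: "('p, 'c) gatom \<Rightarrow> 'p \<times> ('c + nat) list" where
  "shape \<alpha> = (pred \<alpha>,
     map (\<lambda>c. if c \<in> constants then Inl c else Inr (LEAST i. args \<alpha> ! i = c)) (args \<alpha>))"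

lemma shape_eq_imp_extent_subset:
  assumes "shape \<alpha> = shape \<beta>"
  shows "extent \<alpha> \<subseteq> extent \<beta>"
proof -
  obtain P xs Q ys where a: "\<alpha> = Atom P xs" and b: "\<beta> = Atom Q ys"
    by (cases \<alpha>; cases \<beta>)
  let ?f = "\<lambda>zs c. if c \<in> constants then Inl c else Inr (LEAST i. zs ! i = c)"
  have PQ: "P = Q" and m: "map (?f xs) xs = map (?f ys) ys"
    using assms unfolding shape_def a b atom.sel by auto
  have len: "length xs = length ys" using m by (rule map_eq_imp_length_eq)
  \<comment> \<open>A foreign constant goes to the entry of \<open>ys\<close> at its first position
    in \<open>xs\<close>. Values of \<open>h\<close> at foreign constants outside \<open>xs\<close>
    are arbitrary and do not matter.\<close>
  define h where "h c = (if c \<in> constants then c else ys ! (LEAST i. xs ! i = c))" for c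
  have "h (xs ! j) = ys ! j" if j: "j < length xs" for j
  proof -
    have eq: "?f xs (xs ! j) = ?f ys (ys ! j)"
      using arg_cong[OF m, of "\<lambda>l. l ! j"] j len by simp
    show ?thesis
    proof (cases "xs ! j \<in> constants")
      case True
      then show ?thesis using eq by (auto simp: h_def split: if_splits)
    next
      case False
      then have "(LEAST i. xs ! i = xs ! j) = (LEAST i. ys ! i = ys ! j)"
        using eq by (auto split: if_splits)
      moreover have "ys ! (LEAST i. ys ! i = ys ! j) = ys ! j" by (rule LeastI) simp
      ultimately show ?thesis using False by (simp add: h_def)
    qed
  qed
  then have "map h xs = ys" using len by (auto intro: nth_equalityI)
  then have "rename h \<alpha> = \<beta>" using PQ by (simp add: a b rename_def)
  then show ?thesis using extent_rename[of h \<alpha>] by (auto simp: h_def)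
qed

text \<open>An atom that ever holds takes its predicate and arity from a rule head or a fact. Hence
  only finitely many shapes occur among such atoms, and the shape determines the extent.\<close>

lemma finite_range_extent: "finite (range extent)"
proof -
  define \<A> where "\<A> = {\<alpha>. extent \<alpha> \<noteq> {}}"
  define Ar where "Ar = (\<lambda>r. (pred (head r), length (args (head r)))) ` \<Pi> \<union>
    (\<lambda>f. (pred (fst f), length (args (fst f)))) ` D"
  have "finite Ar" using db prog by (auto simp: Ar_def database_def program_def)
  have mem: "(pred \<alpha>, length (args \<alpha>)) \<in> Ar" if "(\<alpha>, t) \<in> M" for \<alpha> t
    using that
  proof (induction rule: min_model_induct)
    case (rule r \<sigma> t)
    have "pred (ground \<sigma> (head r)) = pred (head r)"
      "length (args (ground \<sigma> (head r))) = length (args (head r))"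
      by (cases "head r"; simp add: ground_def)+
    then show ?case using rule(1) by (auto simp: Ar_def)
  qed (force simp: Ar_def)
  \<comment> \<open>If \<open>Ar\<close> is empty, then so is \<A>, and the value of
    \<open>Max\<close> is never relied on.\<close>
  define n where "n = Max (snd ` Ar)"
  define X where "X = Inl ` constants \<union> Inr ` {..n}"
  have "shape \<alpha> \<in> fst ` Ar \<times> {l. set l \<subseteq> X \<and> length l \<le> n}" if "\<alpha> \<in> \<A>" for \<alpha>
  proof -
    have ar: "(pred \<alpha>, length (args \<alpha>)) \<in> Ar" using mem that by (auto simp: \<A>_def extent_iff)
    then have len: "length (args \<alpha>) \<le> n" using \<open>finite Ar\<close> by (auto simp: n_def intro!: Max_ge intro: rev_image_eqI)
    have "(LEAST i. args \<alpha> ! i = c) \<le> n" if "c \<in> set (args \<alpha>)" for c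
    proof -
      obtain j where "j < length (args \<alpha>)" "args \<alpha> ! j = c" using \<open>c \<in> _\<close> by (auto simp: in_set_conv_nth)
      then have "(LEAST i. args \<alpha> ! i = c) \<le> j" by (auto intro: Least_le)
      then show ?thesis using \<open>j < _\<close> len by simp
    qed
    then have "set (snd (shape \<alpha>)) \<subseteq> X" by (auto simp: shape_def X_def)
    moreover have "pred \<alpha> \<in> fst ` Ar" using ar by (force intro: rev_image_eqI)
    ultimately show ?thesis using len by (simp add: shape_def)
  qed
  then have "shape ` \<A> \<subseteq> fst ` Ar \<times> {l. set l \<subseteq> X \<and> length l \<le> n}" by blast
  moreover have "finite X" by (simp add: X_def finite_constants)
  then have "finite (fst ` Ar \<times> {l. set l \<subseteq> X \<and> length l \<le> n})"
    by (intro finite_cartesian_product finite_imageI finite_lists_length_le \<open>finite Ar\<close>)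
  ultimately have "finite (shape ` \<A>)" by (rule finite_subset)
  \<comment> \<open>\<open>inv_into\<close> selects a representative for each shape, which turns the
    extents over \<A> into an image of a finite set.\<close>
  moreover have "extent \<alpha> = extent (inv_into \<A> shape (shape \<alpha>))" if "\<alpha> \<in> \<A>" for \<alpha>
    using shape_eq_imp_extent_subset f_inv_into_f[of "shape \<alpha>" shape \<A>] that by (metis equalityI imageI)
  then have "extent ` \<A> \<subseteq> (\<lambda>v. extent (inv_into \<A> shape v)) ` shape ` \<A>" by blast
  ultimately have "finite (extent ` \<A>)" by (rule finite_surj)
  moreover have "range extent \<subseteq> insert {} (extent ` \<A>)" by (auto simp: \<A>_def)
  ultimately show ?thesis by (meson finite.insertI finite_subset)
qed

lemma dia_interval: "Dia I B H \<in> \<Pi> \<Longrightarrow> is_interval I" "Dia I B H \<in> \<Pi> \<Longrightarrow> i \<in> I \<Longrightarrow> 0 \<le> i"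
  using prog by (auto simp: program_def nonneg_interval_def)

lemma label_nonneg: "r \<in> \<Pi> \<Longrightarrow> w \<in> label r \<Longrightarrow> 0 \<le> w"
  using dia_interval(2) by (cases r) auto

text \<open>There may be infinitely many ground atoms, but they have only finitely many extents, and
  the program has finitely many intervals. So one maximum of thresholds serves them all.\<close>

lemma uniform_threshold:
  "\<exists>T. (\<forall>(A, I) \<in> D. const_beyond T I) \<and>
     (\<forall>\<alpha>. ev_const (extent \<alpha>) \<longrightarrow> const_beyond T (extent \<alpha>)) \<and>
     (\<forall>I B H \<alpha>. Dia I B H \<in> \<Pi> \<longrightarrow> ev_const (extent \<alpha>) \<longrightarrow> const_beyond T (shift I (extent \<alpha>)))"
proof -
  define EC where "EC = {X \<in> range extent. ev_const X}"
  define Is where "Is = {I. \<exists>B H. Dia I B H \<in> \<Pi>}"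
  define F where "F = snd ` D \<union> EC \<union> (\<lambda>(I, X). shift I X) ` (Is \<times> EC)"
  have "finite \<Pi>" using prog by (simp add: program_def)
  moreover have "Is \<subseteq> label ` \<Pi>" by (force simp: Is_def)
  ultimately have "finite Is" using finite_surj by blast
  moreover have "finite EC" using finite_range_extent by (simp add: EC_def)
  ultimately have "finite F" using db by (auto simp: F_def database_def)
  moreover have "ev_const X" if "X \<in> F" for X
  proof -
    consider A where "(A, X) \<in> D" | "X \<in> EC" | I Y where "I \<in> Is" "Y \<in> EC" "X = shift I Y"
      using \<open>X \<in> F\<close> by (auto simp: F_def)
    then show ?thesis
    proof cases
      case 1
      then show ?thesis using db interval_ev_const by (auto simp: database_def)
    next
      case 2
      then show ?thesis by (simp add: EC_def)
    next
      case 3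
      then show ?thesis using dia_interval(1) ev_const_shift by (auto simp: EC_def Is_def)
    qed
  qed
  ultimately obtain T where T: "\<And>X. X \<in> F \<Longrightarrow> const_beyond T X"
    using finite_ev_const by meson
  show ?thesis
  proof (intro exI[of _ T] conjI allI impI ballI)
    show "case f of (A, I) \<Rightarrow> const_beyond T I" if "f \<in> D" for f
      using that T[of "snd f"] by (auto simp: F_def split_beta)
    show "const_beyond T (extent \<alpha>)" if "ev_const (extent \<alpha>)" for \<alpha>
      using that by (intro T) (auto simp: F_def EC_def)
    show "const_beyond T (shift I (extent \<alpha>))" if "Dia I B H \<in> \<Pi>" "ev_const (extent \<alpha>)" for I B H \<alpha>
    proof (rule T)
      have "(I, extent \<alpha>) \<in> Is \<times> EC" using that by (auto simp: Is_def EC_def)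
      then show "shift I (extent \<alpha>) \<in> F" unfolding F_def by force
    qed
  qed
qed

end

section \<open>One strongly connected component\<close>

text \<open>\<open>K\<close> stands for a strongly connected component whose inputs, facts and
  bodies from outside \<open>K\<close>, are settled after \<open>T\<close>. For diamonds this is
  asked of the shifted extent, since the witnessing time may lie long before
  \<open>T\<close>.\<close>

locale stratum = past_datalog \<Pi> D
  for \<Pi> :: "('p, 'c, 'v) rule set" and D :: "('p, 'c) fact set" +
  fixes K :: "'p set" and T :: rat
  assumes fact_const: "(A, I) \<in> D \<Longrightarrow> const_beyond T I"
    and conj_const: "Conj Bs H \<in> \<Pi> \<Longrightarrow> pred H \<in> K \<Longrightarrow> B \<in> set Bs \<Longrightarrow> pred B \<notin> K \<Longrightarrow>
           const_beyond T (extent (ground \<sigma> B))"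
    and dia_const: "Dia I B H \<in> \<Pi> \<Longrightarrow> pred H \<in> K \<Longrightarrow> pred B \<notin> K \<Longrightarrow>
           const_beyond T (shift I (extent (ground \<sigma> B)))"
begin

lemma pred_ground: "pred (ground \<sigma> A) = pred A"
  by (cases A) (simp add: ground_def)

text \<open>Rules inside \<open>K\<close> act at a single time point and all other inputs are
  constant after \<open>T\<close>, so a derivation at one late time can be replayed at any
  other.\<close>

lemma nontemporal_const:
  assumes no_dia: "\<And>I B H. Dia I B H \<in> \<Pi> \<Longrightarrow> pred H \<in> K \<Longrightarrow> pred B \<notin> K"
    and "pred \<alpha> \<in> K"
  shows "const_beyond T (extent \<alpha>)"
proof -
  have "pred \<alpha> \<in> K \<longrightarrow> T < t \<longrightarrow> {T<..} \<subseteq> extent \<alpha>" if "(\<alpha>, t) \<in> M" for \<alpha> t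
    using that
  proof (induction rule: min_model_induct)
    case (rule r \<sigma> t)
    show ?case
    proof (intro impI subsetI)
      fix t' assume K: "pred (ground \<sigma> (head r)) \<in> K" and t: "T < t" "t' \<in> {T<..}"
      show "t' \<in> extent (ground \<sigma> (head r))"
      proof (cases r)
        case (Conj Bs H)
        have "t' \<in> extent (ground \<sigma> B)" if B: "B \<in> set Bs" for B
        proof (cases "pred B \<in> K")
          case True
          then show ?thesis using rule(2) Conj B t by (auto simp: pred_ground)
        next
          case False
          have "const_beyond T (extent (ground \<sigma> B))"
            by (rule conj_const) (use rule(1) Conj K B False in \<open>auto simp: pred_ground\<close>)
          moreover have "t \<in> extent (ground \<sigma> B)" using rule(2) Conj B by (auto simp: extent_iff)
          ultimately show ?thesis using t const_beyondD by simp
        qed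
        then show ?thesis using conj_rule rule(1) Conj by auto
      next
        case (Dia I B H)
        have "pred H \<in> K" using K Dia by (simp add: pred_ground)
        then have "const_beyond T (shift I (extent (ground \<sigma> B)))"
          using rule(1) Dia by (intro dia_const no_dia) auto
        moreover have "t \<in> shift I (extent (ground \<sigma> B))"
          using rule(2) Dia by (auto simp: shift_def extent_iff)
        ultimately have "t' \<in> shift I (extent (ground \<sigma> B))" using t const_beyondD by simp
        then show ?thesis using dia_rule[of I B H \<sigma>] rule(1) Dia by auto
      qed
    qed
  next
    case (fact A I t)
    then show ?case using fact_extent[of A I] fact_const[of A I] const_beyondD[of T I t] by auto
  qed
  then show ?thesis using assms(2) by (fastforce simp: const_beyond_def extent_iff)
qed

section \<open>The graph of classes of ground atoms\<close>

text \<open>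
  A vertex \<open>(P, X)\<close> stands for all ground atoms with predicate \<open>P\<close> that hold exactly at the times in
  \<open>X\<close>. As there are finitely many of them, walks through infinitely many ground atoms still have to
  close up.
\<close>

definition class_edges :: "(('p \<times> rat set) \<times> ('p \<times> rat set)) set" where
  "class_edges = {((src e, X), (tgt e, Y)) | e X Y. e \<in> dep_edges \<Pi> \<and> X \<in> range extent \<and>
     Y \<in> range extent \<and> (\<forall>x \<in> X. \<forall>w \<in> label (rule_of e). T < x \<longrightarrow> x + w \<in> Y)}"

lemma class_edgeI:
  assumes "r \<in> \<Pi>" "B \<in> body r"
    and "\<And>x w. x \<in> extent (ground \<sigma> B) \<Longrightarrow> w \<in> label r \<Longrightarrow> T < x \<Longrightarrow> x + w \<in> extent (ground \<sigma> (head r))"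
  shows "((pred B, extent (ground \<sigma> B)), (pred (head r), extent (ground \<sigma> (head r)))) \<in> class_edges"
proof -
  have "(pred B, r, pred (head r)) \<in> dep_edges \<Pi>" using assms(1,2) by (auto simp: dep_edges_def)
  then show ?thesis unfolding class_edges_def using assms(3) by force
qed

lemma finite_class_edges: "finite class_edges"
proof -
  let ?V = "(src ` dep_edges \<Pi> \<union> tgt ` dep_edges \<Pi>) \<times> range extent"
  have "class_edges \<subseteq> ?V \<times> ?V" unfolding class_edges_def by blast
  moreover have "finite (dep_edges \<Pi>)" using prog by (simp add: program_def finite_dep_edges)
  then have "finite (?V \<times> ?V)" using finite_range_extent by simp
  ultimately show ?thesis by (rule finite_subset)
qed

text \<open>A height on the class graph: equal along cycles, larger across edges that admit no
  return. It counts \<open>v\<close> itself and is therefore at least 1.\<close>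

definition rank :: "'p \<times> rat set \<Rightarrow> nat" where
  "rank v = card {u. (u, v) \<in> class_edges\<^sup>*}"

lemma finite_ancestors: "finite {u. (u, v) \<in> class_edges\<^sup>*}"
  by (rule finite_rtrancl_predecessors[OF finite_class_edges])

lemma rank_pos: "1 \<le> rank v"
proof -
  have "{v} \<subseteq> {u. (u, v) \<in> class_edges\<^sup>*}" by simp
  then have "card {v} \<le> rank v" unfolding rank_def by (intro card_mono finite_ancestors)
  then show ?thesis by simp
qed

lemma rank_mono: "(u, v) \<in> class_edges \<Longrightarrow> rank u \<le> rank v"
  unfolding rank_def
  by (rule card_mono[OF finite_ancestors]) (blast intro: rtrancl_into_rtrancl)

lemma rank_strict_mono:
  assumes "(u, v) \<in> class_edges" "(v, u) \<notin> class_edges\<^sup>*"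
  shows "rank u < rank v"
  unfolding rank_def
proof (rule psubset_card_mono[OF finite_ancestors])
  have "{w. (w, u) \<in> class_edges\<^sup>*} \<subseteq> {w. (w, v) \<in> class_edges\<^sup>*}"
    using assms(1) by (blast intro: rtrancl_into_rtrancl)
  then show "{w. (w, u) \<in> class_edges\<^sup>*} \<subset> {w. (w, v) \<in> class_edges\<^sup>*}"
    using assms(2) by blast
qed

text \<open>A path of classes lies over a walk of predicates, and late truth travels along it by any
  element of the Minkowski sum of the labels.\<close>

lemma class_walk:
  assumes "(u, v) \<in> class_edges\<^sup>*"
  shows "\<exists>es. walk \<Pi> (fst u) es (fst v) \<and> (\<forall>w \<in> weight es. 0 \<le> w) \<and>
    (\<forall>x \<in> snd u. \<forall>w \<in> weight es. T < x \<longrightarrow> x + w \<in> snd v)"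
  using assms
proof (induction rule: converse_rtrancl_induct)
  case base
  show ?case by (rule exI[of _ "[]"]) (simp add: weight_def)
next
  case (step u u')
  obtain es where es: "walk \<Pi> (fst u') es (fst v)" "\<forall>w \<in> weight es. 0 \<le> w"
    "\<forall>x \<in> snd u'. \<forall>w \<in> weight es. T < x \<longrightarrow> x + w \<in> snd v"
    using step by blast
  obtain e where e: "e \<in> dep_edges \<Pi>" "fst u = src e" "fst u' = tgt e"
    "\<forall>x \<in> snd u. \<forall>w \<in> label (rule_of e). T < x \<longrightarrow> x + w \<in> snd u'"
    using step(1) by (auto simp: class_edges_def)
  have "rule_of e \<in> \<Pi>" using e(1) by (auto simp: dep_edges_def)
  then have nn: "0 \<le> w" if "w \<in> label (rule_of e)" for w using that label_nonneg by blast
  have W: "weight (e # es) = label (rule_of e) + weight es" by (simp add: weight_def)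
  have "walk \<Pi> (fst u) (e # es) (fst v)" using e es by simp
  moreover have "0 \<le> w" if "w \<in> weight (e # es)" for w
    using that nn es(2) unfolding W by (fastforce elim!: set_plus_elim)
  moreover have "x + w \<in> snd v" if x: "x \<in> snd u" "T < x" and w: "w \<in> weight (e # es)" for x w
  proof -
    obtain a b where ab: "w = a + b" "a \<in> label (rule_of e)" "b \<in> weight es"
      using w unfolding W by (auto elim!: set_plus_elim)
    \<comment> \<open>Labels are non-negative, so the intermediate time stays beyond
      \<open>T\<close>, where the remaining edges apply.\<close>
    then have "x + a \<in> snd u'" "T < x + a" using e(4) x nn[of a] by auto
    then have "x + a + b \<in> snd v" using es(3) ab by blast
    then show ?thesis using ab by (simp add: add.assoc)
  qed
  ultimately show ?case by blast
qed

text \<open>By linearity, late truth in a class that is not eventually full is inherited from a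
  single body atom in \<open>K\<close>. Every step that moves time raises the rank and moves time by
  a bounded amount, so the class cannot hold arbitrarily late.\<close>

lemma temporal_ev_const:
  assumes linear: "\<And>r B B'. r \<in> \<Pi> \<Longrightarrow> pred (head r) \<in> K \<Longrightarrow> B \<in> body r \<Longrightarrow> B' \<in> body r \<Longrightarrow>
      pred B \<in> K \<Longrightarrow> pred B' \<in> K \<Longrightarrow> B = B'"
    and cycles: "\<And>es. is_cycle \<Pi> es \<Longrightarrow> temporal_acyclic es \<or> positive_interval (weight es)"
    and "pred \<alpha> \<in> K"
  shows "ev_const (extent \<alpha>)"
proof -
  \<comment> \<open>A path back to the body class would close a cycle whose weight is not
    \<open>{0}\<close>, hence positive. Going round it from \<open>s + i\<close> would make the head
    eventually full.\<close>
  have no_return: "rank (pred B, extent (ground \<sigma> B)) < rank (pred H, extent (ground \<sigma> H))"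
    if r: "Dia I B H \<in> \<Pi>" and I: "I \<noteq> {0}" and s: "s \<in> extent (ground \<sigma> B)" "T < s" "i \<in> I"
      and nf: "\<not> ev_full (extent (ground \<sigma> H))" for I B H \<sigma> s i
  proof (rule rank_strict_mono)
    let ?u = "(pred B, extent (ground \<sigma> B))" and ?v = "(pred H, extent (ground \<sigma> H))"
    have step: "x + w \<in> extent (ground \<sigma> H)" if "x \<in> extent (ground \<sigma> B)" "w \<in> I" for x w
    proof -
      have "x + w \<in> shift I (extent (ground \<sigma> B))"
        using that by (auto simp: shift_def intro!: exI[of _ x])
      then show ?thesis using dia_rule[OF r] by blast
    qed
    then show "(?u, ?v) \<in> class_edges" using class_edgeI[OF r, of B \<sigma>] by simp
    show "(?v, ?u) \<notin> class_edges\<^sup>*"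
    proof
      assume "(?v, ?u) \<in> class_edges\<^sup>*"
      then obtain es where es: "walk \<Pi> (pred H) es (pred B)" "\<forall>w \<in> weight es. 0 \<le> w"
        "\<forall>x \<in> extent (ground \<sigma> H). \<forall>w \<in> weight es. T < x \<longrightarrow> x + w \<in> extent (ground \<sigma> B)"
        using class_walk[of ?v ?u] by auto
      define e where "e = (pred B, Dia I B H, pred H)"
      have "e \<in> dep_edges \<Pi>" using r by (force simp: e_def dep_edges_def)
      then have "walk \<Pi> (pred H) (es @ [e]) (pred H)"
        using es(1) by (auto simp: walk_append e_def)
      then have "is_cycle \<Pi> (es @ [e])" by (rule closed_walk_is_cycle) simp
      moreover have W: "weight (es @ [e]) = weight es + I"
        by (simp add: weight_def e_def)
      moreover have "weight es + I \<noteq> {0}"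
      proof
        assume eq: "weight es + I = {0}"
        then obtain a b where ab: "a \<in> weight es" "b \<in> I"
          by (metis set_plus_elim singletonI)
        \<comment> \<open>Non-negative summands with sum 0 both vanish, so weight \<open>{0}\<close>
          would force \<open>I = {0}\<close>.\<close>
        have "c = 0" if "c \<in> I" for c
        proof -
          have "a + c = 0" using eq ab that set_plus_intro by blast
          moreover have "0 \<le> a" "0 \<le> c" using es(2) ab dia_interval(2)[OF r] that by auto
          ultimately show ?thesis by linarith
        qed
        then show False using I ab by auto
      qed
      ultimately have pos: "positive_interval (weight es + I)"
        using cycles unfolding temporal_acyclic_def by metis
      \<comment> \<open>The walk \<open>es\<close> leads from the head class to the body class and
        the diamond leads back, so beyond \<open>T\<close> the extent of the head is closed under
        adding the cycle weight.\<close>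
      have "ev_full (extent (ground \<sigma> H))"
      proof (rule positive_closed_ev_full[OF _ _ pos])
        show "s + i \<in> extent (ground \<sigma> H)" using step s by blast
        show "T < s + i" using s dia_interval(2)[OF r] by force
        fix y w assume y: "y \<in> extent (ground \<sigma> H)" "T < y" and "w \<in> weight es + I"
        then obtain a b where ab: "w = a + b" "a \<in> weight es" "b \<in> I" by (auto elim!: set_plus_elim)
        then have "y + a + b \<in> extent (ground \<sigma> H)" using y es(3) step by blast
        then show "y + w \<in> extent (ground \<sigma> H)" using ab by (simp add: add.assoc)
      qed
      then show False using nf by simp
    qed
  qed
  have "\<exists>R. \<forall>r \<in> \<Pi>. ev_full (label r) \<or> (\<forall>i \<in> label r. i \<le> R)"
  proof (rule finite_common_bound)
    show "finite \<Pi>" using prog by (simp add: program_def)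
    show "\<exists>R. ev_full (label r) \<or> (\<forall>i \<in> label r. i \<le> R)" if "r \<in> \<Pi>" for r
    proof (cases r)
      case (Dia I B H)
      then show ?thesis using interval_bounded_or_ev_full[of I] dia_interval(1) that by auto
    qed auto
  qed (meson order_trans)
  then obtain R' where R': "\<And>r. r \<in> \<Pi> \<Longrightarrow> ev_full (label r) \<or> (\<forall>i \<in> label r. i \<le> R')" by blast
  \<comment> \<open>The maximum with 0 makes the bounds below monotone in the rank.\<close>
  define R where "R = max 0 R'"
  have R: "ev_full I \<or> (\<forall>i \<in> I. i \<le> R)" if "Dia I B H \<in> \<Pi>" for I B H
    using R'[OF that] by (force simp: R_def)
  have "0 \<le> R" by (simp add: R_def)
  \<comment> \<open>Each rank level allows one further time step of length at most \<open>R\<close>.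
    As ranks start at 1, a step back by \<open>R\<close> from beyond the bound still lands after
    \<open>T\<close>.\<close>
  define bnd where "bnd \<alpha> = T + R * of_nat (rank (pred \<alpha>, extent \<alpha>))" for \<alpha>
  have bnd_le: "bnd \<beta> \<le> bnd \<alpha>"
    if "rank (pred \<beta>, extent \<beta>) \<le> rank (pred \<alpha>, extent \<alpha>)" for \<alpha> \<beta>
    using that \<open>0 \<le> R\<close> by (simp add: bnd_def mult_left_mono)
  have bnd_less: "bnd \<beta> + R \<le> bnd \<alpha>"
    if "rank (pred \<beta>, extent \<beta>) < rank (pred \<alpha>, extent \<alpha>)" for \<alpha> \<beta>
  proof -
    have "R * of_nat (Suc (rank (pred \<beta>, extent \<beta>))) \<le> R * of_nat (rank (pred \<alpha>, extent \<alpha>))"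
      using that \<open>0 \<le> R\<close> by (intro mult_left_mono) (auto simp only: of_nat_le_iff Suc_le_eq)
    then show ?thesis by (simp add: bnd_def algebra_simps)
  qed
  have bnd_T: "T + R \<le> bnd \<alpha>" for \<alpha>
  proof -
    have "R * 1 \<le> R * of_nat (rank (pred \<alpha>, extent \<alpha>))"
      using rank_pos[of "(pred \<alpha>, extent \<alpha>)"] \<open>0 \<le> R\<close> by (intro mult_left_mono) auto
    then show ?thesis by (simp add: bnd_def)
  qed
  have main: "pred \<alpha> \<in> K \<longrightarrow> ev_full (extent \<alpha>) \<or> t \<le> bnd \<alpha>" if "(\<alpha>, t) \<in> M" for \<alpha> t
    using that
  proof (induction rule: min_model_induct)
    case (rule r \<sigma> t)
    let ?\<alpha> = "ground \<sigma> (head r)"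
    show ?case
    proof (rule impI, rule ccontr)
      assume K: "pred ?\<alpha> \<in> K" and "\<not> (ev_full (extent ?\<alpha>) \<or> t \<le> bnd ?\<alpha>)"
      then have nf: "\<not> ev_full (extent ?\<alpha>)" and tb: "bnd ?\<alpha> < t" by auto
      have tT: "T < t" using bnd_T[of ?\<alpha>] tb \<open>0 \<le> R\<close> by linarith
      show False
      proof (cases r)
        case (Conj Bs H)
        have inM: "t \<in> extent (ground \<sigma> B)" if "B \<in> set Bs" for B
          using rule(2) Conj that by (auto simp: extent_iff)
        have ext: "t' \<in> extent (ground \<sigma> B)" if "B \<in> set Bs" "pred B \<notin> K" "T < t'" for B t'
        proof -
          have "const_beyond T (extent (ground \<sigma> B))"
            by (rule conj_const) (use rule(1) Conj K that in \<open>auto simp: pred_ground\<close>)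
          then show ?thesis using inM that tT const_beyondD by blast
        qed
        show False
        proof (cases "\<exists>B \<in> set Bs. pred B \<in> K")
          case False
          then have "t' \<in> extent ?\<alpha>" if "T < t'" for t'
            using ext that conj_rule[of Bs H t' \<sigma>] rule(1) Conj by auto
          then show False using nf ev_fullI by blast
        next
          case True
          then obtain B where B: "B \<in> set Bs" "pred B \<in> K" by blast
          have only: "B' = B" if "B' \<in> set Bs" "pred B' \<in> K" for B'
            using linear[OF rule(1), of B' B] Conj K B that by (auto simp: pred_ground)
          \<comment> \<open>After \<open>T\<close> the remaining body atoms hold at all times, so
            the rule acts like an edge with label \<open>{0}\<close> from its one atom in
            \<open>K\<close>.\<close>
          have pass: "t' \<in> extent ?\<alpha>" if "T < t'" "t' \<in> extent (ground \<sigma> B)" for t'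
            using ext only that conj_rule[of Bs H t' \<sigma>] rule(1) Conj by auto
          have "\<not> ev_full (extent (ground \<sigma> B))"
          proof
            assume "ev_full (extent (ground \<sigma> B))"
            then obtain u where "{u<..} \<subseteq> extent (ground \<sigma> B)" by (auto simp: ev_full_def)
            then have "ev_full (extent ?\<alpha>)" by (intro ev_fullI[of "max u T"] pass) auto
            then show False using nf by simp
          qed
          then have "t \<le> bnd (ground \<sigma> B)" using rule(2) Conj B by (auto simp: pred_ground)
          moreover have "bnd (ground \<sigma> B) \<le> bnd ?\<alpha>"
          proof (rule bnd_le)
            have "((pred B, extent (ground \<sigma> B)), (pred (head r), extent ?\<alpha>)) \<in> class_edges"
              by (rule class_edgeI[OF rule(1)]) (use Conj B pass in auto)
            then show "rank (pred (ground \<sigma> B), extent (ground \<sigma> B)) \<le> rank (pred ?\<alpha>, extent ?\<alpha>)"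
              using rank_mono by (simp add: pred_ground)
          qed
          ultimately show False using tb by simp
        qed
      next
        case (Dia I B H)
        have r: "Dia I B H \<in> \<Pi>" using rule(1) Dia by simp
        have sub: "shift I (extent (ground \<sigma> B)) \<subseteq> extent ?\<alpha>" using dia_rule[OF r] Dia by simp
        have nf': "\<not> ev_full (shift I (extent (ground \<sigma> B)))"
          using nf sub unfolding ev_full_def by blast
        obtain s where s: "t - s \<in> I" "s \<in> extent (ground \<sigma> B)"
          "pred B \<in> K \<Longrightarrow> ev_full (extent (ground \<sigma> B)) \<or> s \<le> bnd (ground \<sigma> B)"
          using rule(2) Dia by (auto simp: extent_iff pred_ground)
        \<comment> \<open>A diamond over an atom outside \<open>K\<close> that fires after
          \<open>T\<close> fires at all times after \<open>T\<close>, which would make the head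
          eventually full.\<close>
        have BK: "pred B \<in> K"
        proof (rule ccontr)
          assume "pred B \<notin> K"
          then have "const_beyond T (shift I (extent (ground \<sigma> B)))"
            using dia_const[OF r] K Dia by (simp add: pred_ground)
          moreover have "t \<in> shift I (extent (ground \<sigma> B))" using s by (auto simp: shift_def)
          ultimately show False using nf' const_beyond_full tT by blast
        qed
        have "\<not> ev_full (extent (ground \<sigma> B))" using nf' s(1) ev_full_shift_right by blast
        then have sb: "s \<le> bnd (ground \<sigma> B)" using s(3) BK by simp
        have "\<not> ev_full I" using nf' s(2) ev_full_shift_left by blast
        then have tR: "t \<le> s + R" using R[OF r] s(1) by force
        \<comment> \<open>This is where the level reserved in \<open>bnd_T\<close> is spent: the
          body time is late enough for \<open>no_return\<close> to apply.\<close>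
        have "T < s" using tR tb bnd_T[of ?\<alpha>] by linarith
        show False
        proof (cases "I = {0}")
          case False
          have "bnd (ground \<sigma> B) + R \<le> bnd ?\<alpha>"
            by (rule bnd_less) (use no_return[OF r False s(2) \<open>T < s\<close> s(1)] nf Dia in \<open>simp add: pred_ground\<close>)
          then show False using tb tR sb by linarith
        next
          case True
          \<comment> \<open>With label \<open>{0}\<close> time does not move, so the rank need not
            grow; such edges may lie on cycles.\<close>
          have "((pred B, extent (ground \<sigma> B)), (pred (head r), extent ?\<alpha>)) \<in> class_edges"
          proof (rule class_edgeI[OF rule(1)])
            fix x w assume "x \<in> extent (ground \<sigma> B)" "w \<in> label r"
            then have "x + w \<in> shift I (extent (ground \<sigma> B))"
              using Dia by (auto simp: shift_def intro!: exI[of _ x])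
            then show "x + w \<in> extent ?\<alpha>" using sub by blast
          qed (simp add: Dia)
          then have "bnd (ground \<sigma> B) \<le> bnd ?\<alpha>"
            using rank_mono by (intro bnd_le) (simp add: pred_ground)
          then show False using tb sb s(1) True by auto
        qed
      qed
    qed
  next
    case (fact A I t)
    show ?case
    proof (intro impI, rule ccontr)
      assume "\<not> (ev_full (extent A) \<or> t \<le> bnd A)"
      then have "T < t" "\<not> ev_full (extent A)" using bnd_T[of A] \<open>0 \<le> R\<close> by auto
      \<comment> \<open>A fact that reaches beyond \<open>T\<close> covers every time after
        \<open>T\<close>.\<close>
      moreover have "ev_full I" using const_beyond_full fact_const fact \<open>T < t\<close> by blast
      ultimately show False using fact_extent[OF fact(1)] unfolding ev_full_def by blast
    qed
  qed
  show ?thesis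
  proof (cases "ev_full (extent \<alpha>)")
    case False
    then have "t \<le> bnd \<alpha>" if "t \<in> extent \<alpha>" for t
      using main that assms(3) by (auto simp: extent_iff)
    then show ?thesis by (rule bounded_ev_const)
  qed (rule ev_full_const)
qed

end

section \<open>Induction along the strongly connected components\<close>

context past_datalog
begin

text \<open>The number of predicates from which a predicate is reachable drops strictly on passing
  to a lower component, so the induction hypothesis covers all inputs of the component of
  \<open>pred \<alpha>\<close>.\<close>

lemma extent_ev_const:
  assumes lin: "temporal_linear \<Pi>"
    and cycles: "\<And>es. is_cycle \<Pi> es \<Longrightarrow> temporal_acyclic es \<or> positive_interval (weight es)"
  shows "ev_const (extent \<alpha>)"
proof (induction "card {P. (P, pred \<alpha>) \<in> (dep_rel \<Pi>)\<^sup>*}" arbitrary: \<alpha> rule: less_induct)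
  case less
  let ?E = "(dep_rel \<Pi>)\<^sup>*"
  define Q where "Q = pred \<alpha>"
  define K where "K = {P. (P, Q) \<in> ?E \<and> (Q, P) \<in> ?E}"
  have fin: "finite {P. (P, Q) \<in> ?E}"
  proof (rule finite_rtrancl_predecessors)
    show "finite (dep_rel \<Pi>)" using prog by (simp add: dep_rel_def program_def finite_dep_edges)
  qed
  have lower: "ev_const (extent (ground \<sigma> B))"
    if "r \<in> \<Pi>" "B \<in> body r" "pred (head r) \<in> K" "pred B \<notin> K" for r B \<sigma>
  proof (rule less)
    have BQ: "(pred B, Q) \<in> ?E"
    proof (rule converse_rtrancl_into_rtrancl[OF dep_relI[OF that(1,2)]])
      show "(pred (head r), Q) \<in> ?E" using that(3) by (simp add: K_def)
    qed
    \<comment> \<open>\<open>Q\<close> reaches itself but not \<open>pred B\<close>, which makes the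
      inclusion of predecessor sets proper.\<close>
    then have "(Q, pred B) \<notin> ?E" using that(4) by (simp add: K_def)
    moreover have "{P. (P, pred B) \<in> ?E} \<subseteq> {P. (P, Q) \<in> ?E}"
      using rtrancl_trans[OF _ BQ] by blast
    ultimately have "{P. (P, pred B) \<in> ?E} \<subset> {P. (P, Q) \<in> ?E}" by blast
    moreover have "pred (ground \<sigma> B) = pred B" by (cases B) (simp add: ground_def)
    ultimately show "card {P. (P, pred (ground \<sigma> B)) \<in> ?E} < card {P. (P, pred \<alpha>) \<in> ?E}"
      using psubset_card_mono[OF fin] unfolding Q_def by metis
  qed
  obtain T where T: "\<forall>(A, I) \<in> D. const_beyond T I"
    "\<forall>\<alpha>. ev_const (extent \<alpha>) \<longrightarrow> const_beyond T (extent \<alpha>)"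
    "\<forall>I B H \<alpha>. Dia I B H \<in> \<Pi> \<longrightarrow> ev_const (extent \<alpha>) \<longrightarrow> const_beyond T (shift I (extent \<alpha>))"
    using uniform_threshold by (elim exE conjE) rule
  interpret stratum \<Pi> D K T
  proof
    show "const_beyond T I" if "(A, I) \<in> D" for A I using T(1) that by blast
    show "const_beyond T (extent (ground \<sigma> B))"
      if "Conj Bs H \<in> \<Pi>" "pred H \<in> K" "B \<in> set Bs" "pred B \<notin> K" for Bs H B \<sigma>
      using T(2) lower[OF that(1) _ _ that(4)] that by simp
    show "const_beyond T (shift I (extent (ground \<sigma> B)))"
      if "Dia I B H \<in> \<Pi>" "pred H \<in> K" "pred B \<notin> K" for I B H \<sigma>
    proof -
      have "ev_const (extent (ground \<sigma> B))" by (rule lower[OF that(1)]) (use that in simp_all)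
      then show ?thesis using T(3) that(1) by blast
    qed
  qed
  have "pred \<alpha> \<in> K" by (simp add: K_def Q_def)
  show ?case
  proof (cases "\<exists>I B H. Dia I B H \<in> \<Pi> \<and> pred H \<in> K \<and> pred B \<in> K")
    case False
    then have "const_beyond T (extent \<alpha>)" using nontemporal_const[OF _ \<open>pred \<alpha> \<in> K\<close>] by blast
    then show ?thesis by (auto simp: ev_const_def)
  next
    case True
    then obtain I B H where dia: "Dia I B H \<in> \<Pi>" "pred H \<in> K" "pred B \<in> K" by blast
    \<comment> \<open>One special edge inside the component puts any two of its predicates on a
      common cycle through that edge, so temporal linearity restricts all body atoms in
      \<open>K\<close>.\<close>
    have mut: "temporal_mut_rec \<Pi> P P'" if "P \<in> K" "P' \<in> K" for P P'
    proof (rule temporal_mut_recI[OF dia(1)])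
      have scc: "(P1, P2) \<in> ?E" if "P1 \<in> K" "P2 \<in> K" for P1 P2
        by (rule rtrancl_trans[of P1 Q]) (use that in \<open>simp_all add: K_def\<close>)
      show "(P, P') \<in> ?E" "(P', pred B) \<in> ?E" "(pred H, P) \<in> ?E"
        using scc that dia by blast+
    qed
    have "B1 = B2" if "r \<in> \<Pi>" "pred (head r) \<in> K" "B1 \<in> body r" "B2 \<in> body r" "pred B1 \<in> K" "pred B2 \<in> K"
      for r B1 B2
    proof -
      let ?S = "{B \<in> body r. temporal_mut_rec \<Pi> (pred B) (pred (head r))}"
      have "card ?S \<le> Suc 0"
        using lin that(1) by (simp add: temporal_linear_def temporal_linear_rule_def)
      moreover have "finite ?S" by (simp add: finite_body)
      moreover have "B1 \<in> ?S" "B2 \<in> ?S" using that mut by auto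
      ultimately show ?thesis by (meson card_le_Suc0_iff_eq)
    qed
    then show ?thesis using temporal_ev_const[OF _ cycles \<open>pred \<alpha> \<in> K\<close>] by simp
  qed
qed

end

theorem theorem2:
  fixes \<Pi> :: "('p, 'c, 'v) rule set" and D :: "('p, 'c) fact set"
  assumes "database D"
    and "program \<Pi>"
    and "temporal_linear \<Pi>"
    and "\<And>es. is_cycle \<Pi> es \<Longrightarrow> temporal_acyclic es \<or> positive_interval (weight es)"
  shows "\<exists>T::rat. \<forall>t > T. \<forall>\<alpha> :: ('p, 'c) gatom.
           (\<alpha>, t) \<in> min_model \<Pi> D \<longleftrightarrow> (\<alpha>, T) \<in> min_model \<Pi> D"
proof -
  interpret past_datalog \<Pi> D by unfold_locales (fact assms)+
  obtain T where T: "\<forall>\<alpha>. ev_const (extent \<alpha>) \<longrightarrow> const_beyond T (extent \<alpha>)"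
    using uniform_threshold by (elim exE conjE) rule
  \<comment> \<open>The time \<open>T + 1\<close> is taken as the reference point because
    \<open>const_beyond\<close> speaks only of times strictly after \<open>T\<close>.\<close>
  have "(\<alpha>, t) \<in> M \<longleftrightarrow> (\<alpha>, T + 1) \<in> M" if "T + 1 < t" for t \<alpha>
  proof -
    have "const_beyond T (extent \<alpha>)" using T extent_ev_const[OF assms(3,4)] by blast
    moreover have "T < t" "T < T + 1" using that by auto
    ultimately show ?thesis unfolding const_beyond_def extent_iff by blast
  qed
  then show ?thesis by blast
qed

end
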